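(* Let $n$ be an integer with $n\ge 3$. Then $$\mathrm{CC}(n,2)=\left\lceil \frac{\binom{n}{2}-1}{2}\right\rceil .$$
   Context: For integers $n\ge r+1$, $r\ge 1$, an $(n,r+1,r)$-covering is a family $\mathcal{B}$ of $(r+1)$-subsets of $\{1,\ldots,n\}$, called blocks, such that each $r$-subset of $\{1,\ldots,n\}$ is contained in at least one block. Its size is the number of blocks. The graph $G(\mathcal{B})$ has the blocks as vertices, and two distinct blocks are adjacent if they have an $r$-subset in common (i.e. their intersection has exactly $r$ elements). The covering is connected if $G(\mathcal{B})$ is connected. $\mathrm{CC}(n,r)$ denotes the minimum size of a connected $(n,r+1,r)$-covering. *)

theory Defs
  imports Complex_Main "Graph_Theory.Pair_Digraph" "Graph_Theory.Digraph_Component"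
begin

definition k_subsets :: "nat \<Rightarrow> nat \<Rightarrow> nat set set" where
  "k_subsets n k = {A. A \<subseteq> {1..n} \<and> card A = k}"

text \<open>\<open>covering n r \<B>\<close>: the family \<open>\<B>\<close> is an \<open>(n, r + 1, r)\<close>-covering.\<close>

definition covering :: "nat \<Rightarrow> nat \<Rightarrow> nat set set \<Rightarrow> bool" where
  "covering n r \<B> \<longleftrightarrow>
     \<B> \<subseteq> k_subsets n (r + 1) \<and> (\<forall>R \<in> k_subsets n r. \<exists>A \<in> \<B>. R \<subseteq> A)"

text \<open>The undirected graph \<open>G(\<B>)\<close>, encoded as a digraph with a symmetric arc relation.\<close>

definition covering_graph :: "nat \<Rightarrow> nat set set \<Rightarrow> nat set pair_pre_digraph" where
  "covering_graph r \<B> =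
     \<lparr> pverts = \<B>, parcs = {(A, C). A \<in> \<B> \<and> C \<in> \<B> \<and> A \<noteq> C \<and> card (A \<inter> C) = r} \<rparr>"

definition connected_covering :: "nat \<Rightarrow> nat \<Rightarrow> nat set set \<Rightarrow> bool" where
  "connected_covering n r \<B> \<longleftrightarrow> covering n r \<B> \<and> Digraph_Component.connected (covering_graph r \<B>)"

text \<open>
  The \<open>LEAST\<close> is meaningful only if connected coverings exist, which lemma
  \<open>connected_covering_k_subsets\<close> below shows for \<open>n \<ge> r + 1\<close>.
\<close>

definition CC :: "nat \<Rightarrow> nat \<Rightarrow> nat" where
  "CC n r = (LEAST m. \<exists>\<B>. connected_covering n r \<B> \<and> card \<B> = m)"

lemma finite_connected_covering:
  assumes "connected_covering n r \<B>"
  shows "finite \<B>"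
proof (rule finite_subset)
  show "\<B> \<subseteq> Pow {1..n}"
    using assms by (auto simp: connected_covering_def covering_def k_subsets_def)
qed simp

lemma pair_graph_covering_graph:
  assumes "finite \<B>"
  shows "pair_graph (covering_graph r \<B>)"
proof
  show "finite (parcs (covering_graph r \<B>))"
    by (rule finite_subset[of _ "\<B> \<times> \<B>"]) (auto simp: covering_graph_def assms)
qed (auto simp: covering_graph_def assms symmetric_def Int_commute intro!: symI)

lemma covering_k_subsets:
  assumes "n \<ge> r + 1"
  shows "covering n r (k_subsets n (r + 1))"
  unfolding covering_def
proof (intro conjI ballI subset_refl)
  fix R assume "R \<in> k_subsets n r"
  then have R: "R \<subseteq> {1..n}" "card R = r" by (auto simp: k_subsets_def)
  have fR: "finite R" using R(1) by (rule finite_subset) simp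
  have "R \<noteq> {1..n}" using R(2) assms by auto
  then obtain x where "x \<in> {1..n}" "x \<notin> R" using R(1) by blast
  then have "insert x R \<in> k_subsets n (r + 1)" using R fR by (simp add: k_subsets_def)
  then show "\<exists>A \<in> k_subsets n (r + 1). R \<subseteq> A" by blast
qed

lemma k_subsets_rtrancl:
  assumes "A \<in> k_subsets n (r + 1)" "C \<in> k_subsets n (r + 1)"
  shows "(A, C) \<in> rtrancl_on (k_subsets n (r + 1))
    {(A, C). A \<in> k_subsets n (r + 1) \<and> C \<in> k_subsets n (r + 1) \<and> A \<noteq> C \<and> card (A \<inter> C) = r}"
    (is "_ \<in> rtrancl_on ?V ?E")
  using assms
proof (induction "card (A - C)" arbitrary: A rule: less_induct)
  case less
  have A: "A \<subseteq> {1..n}" "card A = r + 1" and C: "C \<subseteq> {1..n}" "card C = r + 1"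
    using less.prems by (auto simp: k_subsets_def)
  have fA: "finite A" and fC: "finite C" using A(1) C(1) by (auto intro: finite_subset)
  show ?case
  proof (cases "A = C")
    case True
    then show ?thesis using less.prems by simp
  next
    case False
    have "\<not> A \<subseteq> C" "\<not> C \<subseteq> A" 
      using False A(2) C(2) card_subset_eq[OF fC, of A] card_subset_eq[OF fA, of C] by auto
    then obtain x y where x: "x \<in> A" "x \<notin> C" and y: "y \<in> C" "y \<notin> A" by blast
    let ?D = "insert y (A - {x})"
    have "card ?D = r + 1" using A(2) fA x y by simp
    moreover have "?D \<subseteq> {1..n}" using A(1) C(1) y by blast
    ultimately have D: "?D \<in> ?V" by (simp add: k_subsets_def)
    have "A \<inter> ?D = A - {x}" using y by blast
    then have "card (A \<inter> ?D) = r" using A(2) fA x by simp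
    then have AD: "(A, ?D) \<in> ?E" using D less.prems y by auto
    have "?D - C = (A - C) - {x}" using y by auto
    then have "card (?D - C) < card (A - C)" using card_Diff1_less[of "A - C" x] fA x by simp
    then have "(?D, C) \<in> rtrancl_on ?V ?E" using D less.prems(2) by (rule less.hyps)
    then show ?thesis 
      by (rule converse_rtrancl_on_into_rtrancl_on[OF AD]) (rule less.prems(1))
  qed
qed

lemma connected_covering_k_subsets:
  assumes "n \<ge> r + 1"
  shows "connected_covering n r (k_subsets n (r + 1))"
proof -
  let ?V = "k_subsets n (r + 1)"
  let ?G = "covering_graph r ?V"
  have ne: "?V \<noteq> {}"
  proof -
    have "{1..r + 1} \<in> ?V" using assms by (simp add: k_subsets_def)
    then show ?thesis by blast
  qed
  have "(arcs_ends ?G)\<^sup>s = parcs ?G"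
    by (auto simp: covering_graph_def arcs_ends_conv symcl_def Int_commute)
  then have "Digraph_Component.connected ?G"
    unfolding connected_conv using ne k_subsets_rtrancl by (simp add: covering_graph_def)
  then show ?thesis using covering_k_subsets[OF assms] by (simp add: connected_covering_def)
qed

end

theory Submission
  imports Defs
begin

text \<open>
  In integer division the claimed value is \<open>(n choose 2) div 2\<close>; the reason is that a connected
  family of blocks can be built up one block at a time.

  Lower bound, for every \<open>r\<close>: order the blocks so that each one after the first shares an
  \<open>r\<close>-subset with an earlier one. The first block contains \<open>r + 1\<close> subsets of size \<open>r\<close>, and every
  later block contributes at most \<open>r\<close> new ones, so \<open>m\<close> connected blocks contain at most
  \<open>r * m + 1\<close> of them (\<open>card_shadow_le\<close>, applied through \<open>stacked_if_connected\<close>). For \<open>r = 2\<close> this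
  gives \<open>(n choose 2) \<le> 2 * m + 1\<close>.

  Upper bound: adding a triangle whose one side is already covered keeps the family connected
  and can cover two new edges. A new vertex is joined to an even set of old vertices without any
  waste by matching the old vertices in pairs and adding the triangle over each pair; for an odd
  set one edge gets covered twice (\<open>triangulated_add_vertex\<close>). That waste is affordable exactly when
  the number of edges becomes even, so one new vertex suffices to reach every \<open>n\<close> except those with
  \<open>n mod 4 = 2\<close>.
  In that case three vertices are added at once to an odd number of old ones
  (\<open>triangulated_add_three_vertices\<close>): all but three old vertices are matched, and the twelve
  remaining edges are covered, without waste, by six triangles.
\<close>

section \<open>Families built one block at a time\<close>

text \<open>
  The blocks are the facets of a pure simplicial complex; each new facet is glued
  along a codimension-one face. The condition \<open>T \<notin> B\<close> makes the number of construction steps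
  equal to the number of blocks.
\<close>

inductive stacked :: "nat \<Rightarrow> 'a set set \<Rightarrow> bool" for r where
  single: "card T = Suc r \<Longrightarrow> stacked r {T}"
| glue: "stacked r B \<Longrightarrow> T \<notin> B \<Longrightarrow> card T = Suc r \<Longrightarrow> A \<in> B \<Longrightarrow> card (A \<inter> T) = r \<Longrightarrow>
    stacked r (insert T B)"

lemma stacked_finite: "stacked r B \<Longrightarrow> finite B"
  by (induction rule: stacked.induct) auto

lemma stacked_card: "stacked r B \<Longrightarrow> A \<in> B \<Longrightarrow> card A = Suc r"
  by (induction rule: stacked.induct) auto

definition shadow :: "nat \<Rightarrow> 'a set set \<Rightarrow> 'a set set" where
  "shadow r B = {R. card R = r \<and> (\<exists>A\<in>B. R \<subseteq> A)}"

lemma shadow_insert: "shadow r (insert T B) = {R. R \<subseteq> T \<and> card R = r} \<union> shadow r B"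
  by (auto simp: shadow_def)

lemma card_shadow_single:
  assumes "card T = Suc r"
  shows "finite {R. R \<subseteq> T \<and> card R = r}" "card {R. R \<subseteq> T \<and> card R = r} = Suc r"
proof -
  have "finite T" using assms by (simp add: card_ge_0_finite)
  then show "finite {R. R \<subseteq> T \<and> card R = r}" "card {R. R \<subseteq> T \<and> card R = r} = Suc r"
    using n_subsets[of T r] assms by (auto intro: finite_subset[of _ "Pow T"])
qed

text \<open>
  Of the \<open>r + 1\<close> faces of a glued block, the one along which it is glued is not new.
\<close>

lemma card_shadow_le:
  assumes "stacked r B"
  shows "finite (shadow r B) \<and> card (shadow r B) \<le> r * card B + 1"
  using assms
proof induction
  case (single T)
  have "shadow r {T} = {R. R \<subseteq> T \<and> card R = r}" by (auto simp: shadow_def)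
  then show ?case using card_shadow_single[OF single] by simp
next
  case (glue B T A)
  let ?F = "{R. R \<subseteq> T \<and> card R = r}"
  have eq: "shadow r (insert T B) = (?F - {A \<inter> T}) \<union> shadow r B"
    using glue.hyps by (auto simp: shadow_def)
  have "A \<inter> T \<in> ?F" using glue.hyps by auto
  then have "card (?F - {A \<inter> T}) = r" using card_shadow_single[OF glue.hyps(3)] by simp
  then have "card (shadow r (insert T B)) \<le> r + (r * card B + 1)"
    unfolding eq using card_Un_le[of "?F - {A \<inter> T}" "shadow r B"] glue.IH by linarith
  then show ?case
    using glue stacked_finite[OF glue.hyps(1)] card_shadow_single[OF glue.hyps(3)]
    by (simp add: shadow_insert)
qed

section \<open>Stacked families are the connected ones\<close>

abbreviation block_adj :: "nat \<Rightarrow> nat set set \<Rightarrow> nat set rel" where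
  "block_adj r B \<equiv> {(A, C). A \<in> B \<and> C \<in> B \<and> A \<noteq> C \<and> card (A \<inter> C) = r}"

lemma connected_covering_graph_iff:
  "Digraph_Component.connected (covering_graph r B) \<longleftrightarrow>
     B \<noteq> {} \<and> (\<forall>A\<in>B. \<forall>C\<in>B. (A, C) \<in> rtrancl_on B (block_adj r B))"
proof -
  have "(arcs_ends (covering_graph r B))\<^sup>s = block_adj r B"
    by (auto simp: covering_graph_def arcs_ends_conv symcl_def Int_commute)
  then show ?thesis unfolding connected_conv by (simp add: covering_graph_def)
qed

lemma rtrancl_on_leaves:
  assumes "(a, b) \<in> rtrancl_on F R" "a \<in> S" "b \<notin> S"
  obtains x y where "(x, y) \<in> R" "x \<in> S" "y \<in> F" "y \<notin> S"
proof -
  have "b \<notin> S \<longrightarrow> (\<exists>x y. (x, y) \<in> R \<and> x \<in> S \<and> y \<in> F \<and> y \<notin> S)"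
    using assms(1) by (induction rule: rtrancl_on_induct) (use assms(2) in blast)+
  then show thesis using assms(3) that by blast
qed

text \<open>
  A stacked proper subfamily of a connected family can always be enlarged, because some path
  leaves it.
\<close>

lemma stacked_if_connected:
  assumes conn: "Digraph_Component.connected (covering_graph r B)"
    and fin: "finite B" and card: "\<And>A. A \<in> B \<Longrightarrow> card A = Suc r"
  shows "stacked r B"
proof -
  have ne: "B \<noteq> {}" and path: "\<And>A C. A \<in> B \<Longrightarrow> C \<in> B \<Longrightarrow> (A, C) \<in> rtrancl_on B (block_adj r B)"
    using conn by (auto simp: connected_covering_graph_iff)
  have "Suc k \<le> card B \<Longrightarrow> \<exists>S. S \<subseteq> B \<and> stacked r S \<and> card S = Suc k" for k
  proof (induction k)
    case 0
    obtain A where "A \<in> B" using ne by blast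
    then have "{A} \<subseteq> B \<and> stacked r {A} \<and> card {A} = Suc 0"
      using card by (auto intro: stacked.single)
    then show ?case by blast
  next
    case (Suc k)
    then obtain S where S: "S \<subseteq> B" "stacked r S" "card S = Suc k" by auto
    then have "S \<noteq> {}" "S \<noteq> B" using Suc.prems by auto
    then obtain A C where "A \<in> S" "C \<in> B" "C \<notin> S" using S(1) by blast
    then obtain X Y where XY: "(X, Y) \<in> block_adj r B" "X \<in> S" "Y \<in> B" "Y \<notin> S"
      using path S(1) rtrancl_on_leaves[of A C B "block_adj r B" S] by blast
    then have "stacked r (insert Y S)" using S(2) card by (auto intro: stacked.glue)
    moreover have "card (insert Y S) = Suc (Suc k)"
      using S(3) XY(4) stacked_finite[OF S(2)] by simp
    ultimately show ?case using S(1) XY(3) by blast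
  qed
  from this[of "card B - 1"] obtain S where "S \<subseteq> B" "stacked r S" "card S = card B"
    using ne fin card_gt_0_iff[of B] by auto
  then show ?thesis using card_subset_eq[OF fin, of S] by simp
qed

lemma connected_if_stacked:
  assumes "stacked r B"
  shows "Digraph_Component.connected (covering_graph r B)"
  unfolding connected_covering_graph_iff using assms
proof induction
  case (single T)
  then show ?case by simp
next
  case (glue B T A)
  let ?B = "insert T B"
  let ?R = "rtrancl_on ?B (block_adj r ?B)"
  have old: "(X, Y) \<in> ?R" if "X \<in> B" "Y \<in> B" for X Y
  proof (rule rtrancl_on_mono)
    show "(X, Y) \<in> rtrancl_on B (block_adj r B)" using glue.IH that by blast
  qed auto
  have edge: "(A, T) \<in> block_adj r ?B" "(T, A) \<in> block_adj r ?B"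
    using glue.hyps by (auto simp: Int_commute)
  have "(X, T) \<in> ?R" "(T, X) \<in> ?R" if "X \<in> B" for X
    using rtrancl_on_into_rtrancl_on[OF old edge(1)] that glue.hyps(4)
      converse_rtrancl_on_into_rtrancl_on[OF edge(2) old] by auto
  then show ?case using old by auto
qed

section \<open>The lower bound\<close>

lemma connected_covering_lower_bound:
  assumes "connected_covering n r B"
  shows "n choose r \<le> r * card B + 1"
proof -
  have cov: "covering n r B" and conn: "Digraph_Component.connected (covering_graph r B)"
    using assms by (auto simp: connected_covering_def)
  have st: "stacked r B"
    using cov by (intro stacked_if_connected[OF conn finite_connected_covering[OF assms]])
      (auto simp: covering_def k_subsets_def)
  have "n choose r = card (k_subsets n r)"
    using n_subsets[of "{1..n}" r] by (simp add: k_subsets_def)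
  also have "\<dots> \<le> card (shadow r B)"
    using cov card_shadow_le[OF st]
    by (intro card_mono) (auto simp: covering_def shadow_def k_subsets_def)
  also have "\<dots> \<le> r * card B + 1" using card_shadow_le[OF st] by simp
  finally show ?thesis .
qed

section \<open>Gluing triangles\<close>

definition covers :: "'a set set \<Rightarrow> 'a \<Rightarrow> 'a \<Rightarrow> bool" where
  "covers B p q \<longleftrightarrow> (\<exists>A\<in>B. p \<in> A \<and> q \<in> A)"

lemma covers_insert: "covers (insert T B) p q \<longleftrightarrow> p \<in> T \<and> q \<in> T \<or> covers B p q"
  by (auto simp: covers_def)

lemma covers_mono: "covers B p q \<Longrightarrow> B \<subseteq> B' \<Longrightarrow> covers B' p q"
  by (auto simp: covers_def)

lemma covers_sym: "covers B p q \<Longrightarrow> covers B q p"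
  by (auto simp: covers_def)

lemma covers_all_insert:
  assumes "\<And>p q. p \<in> V \<Longrightarrow> q \<in> V \<Longrightarrow> p \<noteq> q \<Longrightarrow> covers B p q"
    and "\<And>p. p \<in> V \<Longrightarrow> covers B v p"
  shows "\<forall>p\<in>insert v V. \<forall>q\<in>insert v V. p \<noteq> q \<longrightarrow> covers B p q"
  using assms by (metis covers_sym insertE)

lemma glue_triangle:
  assumes "stacked 2 B" "covers B p q" "p \<noteq> q" "v \<noteq> p" "v \<noteq> q"
  shows "stacked 2 (insert {v, p, q} B)"
proof (cases "{v, p, q} \<in> B")
  case True
  then show ?thesis using assms(1) by (simp add: insert_absorb)
next
  case False
  obtain A where A: "A \<in> B" "p \<in> A" "q \<in> A" using assms(2) by (auto simp: covers_def)
  have cA: "card A = 3" using stacked_card[OF assms(1) A(1)] by simp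
  \<comment> \<open>If \<open>v\<close> were in \<open>A\<close>, the two triples would coincide.\<close>
  have "v \<notin> A"
  proof
    assume "v \<in> A"
    then have "{v, p, q} = A"
      using A cA assms by (intro card_subset_eq) (auto intro: card_ge_0_finite)
    then show False using A(1) False by simp
  qed
  then have "A \<inter> {v, p, q} = {p, q}" using A by auto
  then show ?thesis using assms A False by (intro stacked.glue[of _ _ _ A]) auto
qed

text \<open>
  The triangles joining \<open>v\<close> to the pairs of a perfect matching of \<open>S\<close>.
\<close>

lemma cone_over_matching:
  assumes "finite S" "even (card S)" "stacked 2 B" "v \<notin> S"
    and "\<And>p q. p \<in> S \<Longrightarrow> q \<in> S \<Longrightarrow> p \<noteq> q \<Longrightarrow> covers B p q"
  shows "\<exists>B'. B \<subseteq> B' \<and> stacked 2 B' \<and> \<Union>B' \<subseteq> \<Union>B \<union> insert v S \<and> (\<forall>p\<in>S. covers B' v p) \<and>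
    card B' \<le> card B + card S div 2"
  using assms
proof (induction "card S" arbitrary: S rule: less_induct)
  case less
  show ?case
  proof (cases "S = {}")
    case True
    then show ?thesis using less.prems(3) by (intro exI[of _ B]) auto
  next
    case False
    then obtain p where p: "p \<in> S" by blast
    have "S \<noteq> {p}" using less.prems(2) by auto
    then obtain q where q: "q \<in> S" "q \<noteq> p" using p by blast
    let ?S = "S - {p, q}"
    have card: "card S = card ?S + 2"
      using p q less.prems(1) card_Diff_subset[of "{p, q}" S] card_mono[of S "{p, q}"] by auto
    obtain B' where B': "B \<subseteq> B'" "stacked 2 B'" "\<Union>B' \<subseteq> \<Union>B \<union> insert v ?S"
      "\<forall>s\<in>?S. covers B' v s" "card B' \<le> card B + card ?S div 2"
      using less.hyps[of ?S] less.prems card by auto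
    have "covers B' p q" using less.prems(5) p q B'(1) covers_mono by metis
    then have "stacked 2 (insert {v, p, q} B')"
      using less.prems(4) p q B'(2) by (intro glue_triangle) auto
    moreover have "card (insert {v, p, q} B') \<le> card B + card S div 2"
      using B'(5) card card_insert_le_m1[of "Suc (card B')" B' "{v, p, q}"] by simp
    ultimately show ?thesis using B' p q
      by (intro exI[of _ "insert {v, p, q} B'"]) (auto simp: covers_insert)
  qed
qed

section \<open>Covering the edges of a complete graph\<close>

text \<open>
  The bound \<open>m\<close> is only an upper one: then a triangle that is glued twice does no harm, and
  equality comes from the lower bound at the end.
\<close>

definition triangulated :: "'a set \<Rightarrow> nat \<Rightarrow> bool" where
  "triangulated V m \<longleftrightarrow> (\<exists>B. stacked 2 B \<and> \<Union>B \<subseteq> V \<and> card B \<le> m \<and>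
     (\<forall>p\<in>V. \<forall>q\<in>V. p \<noteq> q \<longrightarrow> covers B p q))"

lemma triangulated_triangle:
  assumes "card V = 3"
  shows "triangulated V 1"
  unfolding triangulated_def
  by (rule exI[of _ "{V}"]) (use assms in \<open>auto intro: stacked.single simp: covers_def\<close>)

text \<open>
  If \<open>card V\<close> is odd, the vertex left over by the matching is joined to \<open>v\<close> by one more triangle,
  whose third vertex is an arbitrary element of \<open>V\<close>.
\<close>

lemma triangulated_add_vertex:
  assumes "triangulated V m" "finite V" "v \<notin> V" "card V \<ge> 2"
  shows "triangulated (insert v V) (m + (card V + 1) div 2)"
proof -
  obtain B where B: "stacked 2 B" "\<Union>B \<subseteq> V" "card B \<le> m"
    "\<And>p q. p \<in> V \<Longrightarrow> q \<in> V \<Longrightarrow> p \<noteq> q \<Longrightarrow> covers B p q"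
    using assms(1) by (auto simp: triangulated_def)
  show ?thesis
  proof (cases "even (card V)")
    case True
    obtain B' where B': "B \<subseteq> B'" "stacked 2 B'" "\<Union>B' \<subseteq> \<Union>B \<union> insert v V"
      "\<forall>p\<in>V. covers B' v p" "card B' \<le> card B + card V div 2"
      using cone_over_matching[OF assms(2) True B(1) assms(3) B(4)] by blast
    have "\<Union>B' \<subseteq> insert v V" using B'(3) B(2) by blast
    moreover have "card B' \<le> m + (card V + 1) div 2"
      using B'(5) B(3) div_le_mono[of "card V" "card V + 1" 2] by linarith
    moreover have "\<forall>p\<in>insert v V. \<forall>q\<in>insert v V. p \<noteq> q \<longrightarrow> covers B' p q"
    proof (rule covers_all_insert)
      show "covers B' p q" if "p \<in> V" "q \<in> V" "p \<noteq> q" for p q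
        by (rule covers_mono[OF B(4)[OF that] B'(1)])
    qed (use B'(4) in blast)
    ultimately show ?thesis unfolding triangulated_def using B'(2) by (intro exI[of _ B'] conjI)
  next
    case False
    obtain x y where xy: "x \<in> V" "y \<in> V" "x \<noteq> y"
      using assms(4) by (metis card_le_Suc0_iff_eq[OF assms(2)] not_less_eq_eq numeral_2_eq_2)
    define S where "S = V - {x}"
    have S: "finite S" "v \<notin> S" "V = insert x S" "card V = Suc (card S)"
      using xy(1) assms(2,3) card.remove[of V x] unfolding S_def by auto
    have "even (card S)" using False S(4) by presburger
    then obtain B' where
      B': "B \<subseteq> B'" "stacked 2 B'" "\<Union>B' \<subseteq> \<Union>B \<union> insert v S"
      "\<forall>p\<in>S. covers B' v p" "card B' \<le> card B + card S div 2"
      using cone_over_matching[OF S(1) _ B(1) S(2)] B(4) unfolding S(3) by blast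
    let ?B = "insert {v, x, y} B'"
    have "stacked 2 ?B"
      using B'(2) covers_mono[OF B(4)[OF xy] B'(1)] xy assms(3) by (intro glue_triangle) auto
    moreover have "\<Union>?B \<subseteq> insert v V" using B'(3) B(2) xy S(3) by blast
    moreover have "card ?B \<le> m + (card V + 1) div 2"
    proof -
      have "card ?B \<le> Suc (card B')" by (rule card_insert_le_m1) simp_all
      moreover have "(card V + 1) div 2 = Suc (card S div 2)" unfolding S(4) by simp
      ultimately show ?thesis using B'(5) B(3) by linarith
    qed
    moreover have "\<forall>p\<in>insert v V. \<forall>q\<in>insert v V. p \<noteq> q \<longrightarrow> covers ?B p q"
    proof (rule covers_all_insert)
      show "covers ?B p q" if "p \<in> V" "q \<in> V" "p \<noteq> q" for p q
        using covers_mono[OF B(4)[OF that] B'(1)] by (simp add: covers_insert)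
      show "covers ?B v p" if "p \<in> V" for p
        using B'(4) that unfolding S(3) covers_insert by blast
    qed
    ultimately show ?thesis unfolding triangulated_def by (intro exI[of _ ?B] conjI)
  qed
qed

text \<open>
  Three old vertices \<open>x, y, z\<close> are left out of the matching. Besides \<open>ab, bc, ca\<close> the new vertices
  still need their nine edges to \<open>x, y, z\<close>; in the order
  \<open>axy, abx, byz, bcx, acy, acz\<close> each triangle has exactly one side that is already covered.
\<close>

lemma triangulated_add_three_vertices:
  assumes "triangulated V m" "finite V" "odd (card V)" "card V \<ge> 3"
    and new: "a \<notin> V" "b \<notin> V" "c \<notin> V" "a \<noteq> b" "a \<noteq> c" "b \<noteq> c"
  shows "triangulated ({a, b, c} \<union> V) (m + 3 * (card V + 1) div 2)"
proof -
  obtain B where B: "stacked 2 B" "\<Union>B \<subseteq> V" "card B \<le> m"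
    "\<And>p q. p \<in> V \<Longrightarrow> q \<in> V \<Longrightarrow> p \<noteq> q \<Longrightarrow> covers B p q"
    using assms(1) by (auto simp: triangulated_def)
  obtain U where "U \<subseteq> V" "card U = 3" using obtain_subset_with_card_n[OF assms(4)] by blast
  then obtain x y z where xyz: "x \<in> V" "y \<in> V" "z \<in> V" "x \<noteq> y" "x \<noteq> z" "y \<noteq> z"
    by (auto simp: card_3_iff)
  define S where "S = V - {x, y, z}"
  have S: "finite S" "S \<subseteq> V" using assms(2) by (auto simp: S_def)
  have card: "card V = card S + 3"
    using xyz assms(2,4) card_Diff_subset[of "{x, y, z}" V] by (simp add: S_def)
  then have even: "even (card S)" using assms(3) by simp
  obtain B1 where B1: "B \<subseteq> B1" "stacked 2 B1" "\<Union>B1 \<subseteq> \<Union>B \<union> insert a S"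
    "\<forall>p\<in>S. covers B1 a p" "card B1 \<le> card B + card S div 2"
    using cone_over_matching[OF S(1) even B(1), of a] B(4) S(2) new by blast
  obtain B2 where B2: "B1 \<subseteq> B2" "stacked 2 B2" "\<Union>B2 \<subseteq> \<Union>B1 \<union> insert b S"
    "\<forall>p\<in>S. covers B2 b p" "card B2 \<le> card B1 + card S div 2"
    using cone_over_matching[OF S(1) even B1(2), of b] covers_mono[OF B(4) B1(1)] S(2) new by blast
  have B_B2: "B \<subseteq> B2" using B1(1) B2(1) by blast
  obtain B3 where B3: "B2 \<subseteq> B3" "stacked 2 B3" "\<Union>B3 \<subseteq> \<Union>B2 \<union> insert c S"
    "\<forall>p\<in>S. covers B3 c p" "card B3 \<le> card B2 + card S div 2"
    using cone_over_matching[OF S(1) even B2(2), of c] covers_mono[OF B(4) B_B2] S(2) new by blast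
  have old: "covers B3 p q" if "p \<in> V" "q \<in> V" "p \<noteq> q" for p q
    using covers_mono[OF B(4)[OF that]] B_B2 B3(1) by blast
  have cones: "covers B3 a p" "covers B3 b p" "covers B3 c p" if "p \<in> S" for p
    using B1(4) B2(1,4) B3(1,4) that by (meson covers_mono order_trans)+
  have neq: "a \<noteq> x" "a \<noteq> y" "a \<noteq> z" "b \<noteq> x" "b \<noteq> y" "b \<noteq> z" "c \<noteq> x" "c \<noteq> y" "c \<noteq> z"
    using new xyz by auto
  define T1 where "T1 = insert {a, x, y} B3"
  define T2 where "T2 = insert {b, a, x} T1"
  define T3 where "T3 = insert {b, y, z} T2"
  define T4 where "T4 = insert {c, b, x} T3"
  define T5 where "T5 = insert {c, a, y} T4"
  define T6 where "T6 = insert {z, a, c} T5"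
  note defs = T6_def T5_def T4_def T3_def T2_def T1_def
  have "stacked 2 T1" unfolding T1_def using neq xyz old B3(2) by (intro glue_triangle) auto
  then have "stacked 2 T2" unfolding T2_def
    using neq new xyz by (intro glue_triangle) (auto simp: T1_def covers_insert)
  then have "stacked 2 T3" unfolding T3_def
    using neq new xyz old by (intro glue_triangle) (auto simp: T1_def T2_def covers_insert)
  then have "stacked 2 T4" unfolding T4_def
    using neq new xyz old by (intro glue_triangle) (auto simp: T1_def T2_def T3_def covers_insert)
  then have "stacked 2 T5" unfolding T5_def
    using neq new xyz old
    by (intro glue_triangle) (auto simp: T1_def T2_def T3_def T4_def covers_insert)
  then have "stacked 2 T6" unfolding T6_def
    using neq new xyz old
    by (intro glue_triangle) (auto simp: T1_def T2_def T3_def T4_def T5_def covers_insert)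
  moreover have "\<Union>T6 \<subseteq> {a, b, c} \<union> V"
    using B(2) B1(3) B2(3) B3(3) S(2) xyz by (fastforce simp: defs)
  moreover have "card T6 \<le> m + 3 * (card V + 1) div 2"
  proof -
    have step: "card (insert X F) \<le> Suc (card F)" for X and F :: "'a set set"
      by (rule card_insert_le_m1) auto
    have "card T6 \<le> card B3 + 6"
      using step[of "{a, x, y}" B3] step[of "{b, a, x}" T1] step[of "{b, y, z}" T2]
        step[of "{c, b, x}" T3] step[of "{c, a, y}" T4] step[of "{z, a, c}" T5]
      by (fold defs) linarith
    also have "\<dots> \<le> m + 3 * (card S div 2) + 6" using B(3) B1(5) B2(5) B3(5) by linarith
    also have "\<dots> = m + 3 * (card V + 1) div 2" using card even by (auto elim!: evenE)
    finally show ?thesis .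
  qed
  moreover have "covers T6 p q" if pq: "p \<in> {a, b, c} \<union> V" "q \<in> {a, b, c} \<union> V" "p \<noteq> q" for p q
  proof -
    have V: "V = {x, y, z} \<union> S" using xyz by (auto simp: S_def)
    have a: "covers T6 a s" and b: "covers T6 b s" and c: "covers T6 c s" if "s \<in> V" for s
      using that cones unfolding V by (auto simp: defs covers_insert)
    have "covers T6 a b" "covers T6 a c" "covers T6 b c" by (auto simp: defs covers_insert)
    moreover have "covers T6 s t" if "s \<in> V" "t \<in> V" "s \<noteq> t" for s t
      using old[OF that] by (simp add: defs covers_insert)
    ultimately show ?thesis using pq a b c covers_sym[of T6] by blast
  qed
  ultimately show ?thesis unfolding triangulated_def by blast
qed

section \<open>The value of \<open>CC n 2\<close>\<close>

lemma choose_two_Suc: "Suc m choose 2 = (m choose 2) + m"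
  by (simp add: numeral_2_eq_2)

text \<open>
  For odd \<open>m\<close> the rounding on the right-hand side is compensated if \<open>m choose 2\<close> is odd, that is,
  if \<open>m mod 4 = 3\<close>.
\<close>

lemma half_choose_two_Suc:
  assumes "m mod 4 \<noteq> 1"
  shows "(Suc m choose 2) div 2 = (m choose 2) div 2 + (m + 1) div 2"
proof (cases "even m")
  case True
  have "(N + m) div 2 = N div 2 + (m + 1) div 2" for N using True by presburger
  then show ?thesis by (simp only: choose_two_Suc)
next
  case False
  obtain k where k: "m = 4 * k + 3" using assms False by (intro that[of "m div 4"]) presburger
  have "m choose 2 = (4 * k + 3) * (2 * k + 1)"
  proof -
    have "m * (m - 1) = 2 * ((4 * k + 3) * (2 * k + 1))" unfolding k by (simp add: algebra_simps)
    then show ?thesis by (simp add: choose_two)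
  qed
  then have "odd (m choose 2)" by simp
  moreover have "(N + m) div 2 = N div 2 + (m + 1) div 2" if "odd N" for N
    using that False by presburger
  ultimately show ?thesis by (simp only: choose_two_Suc)
qed

lemma half_choose_two_add_3:
  assumes "odd m"
  shows "((m + 3) choose 2) div 2 = (m choose 2) div 2 + 3 * (m + 1) div 2"
proof -
  have "(m + 3) choose 2 = (m choose 2) + (3 * m + 3)"
    using choose_two_Suc[of m] choose_two_Suc[of "Suc m"] choose_two_Suc[of "Suc (Suc m)"]
    by (simp add: eval_nat_numeral)
  moreover have "(N + (3 * m + 3)) div 2 = N div 2 + 3 * (m + 1) div 2" for N
    using assms by presburger
  ultimately show ?thesis by simp
qed

text \<open>
  For \<open>n mod 4 = 2\<close> the single-vertex step from \<open>n - 1\<close> would need one block too many.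
\<close>

lemma triangulated_interval:
  assumes "n \<ge> 3"
  shows "triangulated {1..n} ((n choose 2) div 2)"
  using assms
proof (induction n rule: less_induct)
  case (less n)
  show ?case
  proof (cases "n = 3")
    case True
    then show ?thesis using triangulated_triangle[of "{1..3::nat}"] by (simp add: choose_two)
  next
    case False
    then have n4: "n \<ge> 4" using less.prems by simp
    show ?thesis
    proof (cases "n mod 4 = 2")
      case True
      define k where "k = n div 4 - 1"
      define m where "m = 4 * k + 3"
      have "n = 4 * k + 6" using True n4 unfolding k_def by presburger
      then have n: "n = m + 3" and m: "m \<ge> 3" "odd m" by (simp_all add: m_def)
      have V: "{m + 1, m + 2, m + 3} \<union> {1..m} = {1..n}" using n by auto
      have "triangulated ({m + 1, m + 2, m + 3} \<union> {1..m})
          ((m choose 2) div 2 + 3 * (card {1..m} + 1) div 2)"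
        using less.IH[OF _ m(1)] n m by (intro triangulated_add_three_vertices) simp_all
      then show ?thesis by (simp only: V card_atLeastAtMost n half_choose_two_add_3[OF m(2)]) simp
    next
      case mod: False
      define m where "m = n - 1"
      have n: "n = Suc m" and m: "m \<ge> 3" using n4 by (simp_all add: m_def)
      have m4: "m mod 4 \<noteq> 1" using mod by (auto simp: n mod_Suc)
      have V: "insert (Suc m) {1..m} = {1..n}" using n by auto
      have "triangulated (insert (Suc m) {1..m}) ((m choose 2) div 2 + (card {1..m} + 1) div 2)"
        using less.IH[OF _ m] n m by (intro triangulated_add_vertex) simp_all
      then show ?thesis by (simp only: V card_atLeastAtMost n half_choose_two_Suc[OF m4]) simp
    qed
  qed
qed

lemma connected_covering_if_triangulated:
  assumes "triangulated {1..n} m"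
  shows "\<exists>B. connected_covering n 2 B \<and> card B \<le> m"
proof -
  obtain B where B: "stacked 2 B" "\<Union>B \<subseteq> {1..n}" "card B \<le> m"
    "\<forall>p\<in>{1..n}. \<forall>q\<in>{1..n}. p \<noteq> q \<longrightarrow> covers B p q"
    using assms by (auto simp: triangulated_def)
  have "covering n 2 B"
    unfolding covering_def
  proof (intro conjI ballI)
    show "B \<subseteq> k_subsets n (2 + 1)"
      using B(2) stacked_card[OF B(1)] by (auto simp: k_subsets_def)
  next
    fix R assume "R \<in> k_subsets n 2"
    then obtain p q where "R = {p, q}" "p \<noteq> q" "p \<in> {1..n}" "q \<in> {1..n}"
      by (auto simp: k_subsets_def card_2_iff)
    then show "\<exists>A\<in>B. R \<subseteq> A" using B(4) unfolding covers_def by blast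
  qed
  then show ?thesis
    using B connected_if_stacked[OF B(1)] by (auto simp: connected_covering_def)
qed

theorem theorem3p2:
  fixes n :: nat
  assumes "n \<ge> 3"
  shows "int (CC n 2) = \<lceil>(real (n choose 2) - 1) / 2\<rceil>"
proof -
  have lower: "(n choose 2) div 2 \<le> card B" if "connected_covering n 2 B" for B
    using connected_covering_lower_bound[OF that] by simp
  obtain B where B: "connected_covering n 2 B" "card B \<le> (n choose 2) div 2"
    using connected_covering_if_triangulated[OF triangulated_interval[OF assms]] by blast
  have "CC n 2 = (n choose 2) div 2"
    unfolding CC_def
  proof (rule Least_equality)
    show "\<exists>\<B>. connected_covering n 2 \<B> \<and> card \<B> = (n choose 2) div 2"
      using B lower[OF B(1)] by (intro exI[of _ B]) simp
  qed (use lower in blast)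
  moreover have "\<lceil>(real N - 1) / 2\<rceil> = int (N div 2)" for N :: nat
    by (cases "even N") (auto elim!: evenE oddE simp: ceiling_eq_iff)
  ultimately show ?thesis by simp
qed

end
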